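(* Let $m,q\in\mathbb{N}^+$ and let $f(x)=\sum_{i,j=1}^m A_{ij}\,x_ix_j$ be a symmetric quadratic homogeneous matrix-valued polynomial, where $A_{ij}=A_{ji}^T\in\mathbb{R}^{q\times q}$ for all $i,j$. Define the coefficient matrix $$\mathcal{A}=\begin{pmatrix}A_{11}&\cdots&A_{1m}\\ \vdots&\ddots&\vdots\\ A_{m1}&\cdots&A_{mm}\end{pmatrix}\in\mathbb{SR}^{mq}.$$ Then $f(X)$ is positive semidefinite for all $n\in\mathbb{N}^+$ and all $X\in(\mathbb{SR}^n)^m$ if and only if $\mathcal{A}$ is positive semidefinite.
   Context: $\mathbb{N}^+$ is the set of positive integers. $\mathbb{SR}^n$ is the set of real symmetric $n\times n$ matrices, and $(\mathbb{SR}^n)^m$ is the set of $m$-tuples $X=(X_1,\dots,X_m)$ of such matrices. The variables $x_1,\dots,x_m$ are noncommuting symmetric variables. The evaluation of $f$ at $X\in(\mathbb{SR}^n)^m$ is $f(X)=\sum_{i,j=1}^m A_{ij}\otimes X_iX_j\in\mathbb{SR}^{qn}$, where $\otimes$ is the Kronecker product. *)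

theory Defs
  imports Complex_Main "Jordan_Normal_Form.Matrix"
begin

definition sym_mats :: "nat \<Rightarrow> real mat set" where
  "sym_mats n = {M \<in> carrier_mat n n. transpose_mat M = M}"

definition pos_semidef :: "real mat \<Rightarrow> bool" where
  "pos_semidef M \<longleftrightarrow> M \<in> sym_mats (dim_row M) \<and>
     (\<forall>v \<in> carrier_vec (dim_row M). 0 \<le> v \<bullet> (M *\<^sub>v v))"

definition kron :: "real mat \<Rightarrow> real mat \<Rightarrow> real mat" where
  "kron A B = mat (dim_row A * dim_row B) (dim_col A * dim_col B)
     (\<lambda>(r, c). A $$ (r div dim_row B, c div dim_col B) * B $$ (r mod dim_row B, c mod dim_col B))"

text \<open>
  The polynomial \<open>f(x) = \<Sum> A i j x\<^sub>i x\<^sub>j\<close> is given by its coefficients \<open>A i j\<close>. Indices run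
  over \<open>0, \<dots>, m - 1\<close>, and values outside this range are irrelevant.  Matrices of varying dimension
  form no additive monoid as a type, so the sum is taken in the module of matrices of order
  \<open>q * n\<close>.
\<close>

definition quad_eval ::
  "nat \<Rightarrow> nat \<Rightarrow> (nat \<Rightarrow> nat \<Rightarrow> real mat) \<Rightarrow> nat \<Rightarrow> (nat \<Rightarrow> real mat) \<Rightarrow> real mat" where
  "quad_eval m q A n X =
     (let M = module_mat TYPE(real) (q * n) (q * n)
      in \<Oplus>\<^bsub>M\<^esub>i\<in>{..<m}. \<Oplus>\<^bsub>M\<^esub>j\<in>{..<m}. kron (A i j) (X i * X j))"

definition coeff_mat :: "nat \<Rightarrow> nat \<Rightarrow> (nat \<Rightarrow> nat \<Rightarrow> real mat) \<Rightarrow> real mat" where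
  "coeff_mat m q A =
     mat (m * q) (m * q) (\<lambda>(r, c). A (r div q) (c div q) $$ (r mod q, c mod q))"

lemma finsum_mat_index:
  assumes "finite S" "\<And>s. s \<in> S \<Longrightarrow> F s \<in> carrier_mat nr nc" "r < nr" "c < nc"
  shows "finsum (module_mat TYPE(real) nr nc) F S \<in> carrier_mat nr nc \<and>
    finsum (module_mat TYPE(real) nr nc) F S $$ (r, c) = (\<Sum>s\<in>S. F s $$ (r, c))"
proof -
  interpret abelian_group "module_mat TYPE(real) nr nc"
    by (rule abelian_group_mat)
  show ?thesis
    using assms(1,2)
  proof (induction S)
    case empty
    then show ?case using assms(3,4) by (simp add: module_mat_simps)
  next
    case (insert x S)
    have "F \<in> S \<rightarrow> carrier (module_mat TYPE(real) nr nc)"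
      "F x \<in> carrier (module_mat TYPE(real) nr nc)"
      using insert.prems by (auto simp: module_mat_simps)
    then show ?case
      using insert assms(3,4)
        carrier_matD[of "finsum (module_mat TYPE(real) nr nc) F S" nr nc]
      by (simp add: finsum_insert module_mat_simps)
  qed
qed

lemma quad_eval_index:
  assumes "\<And>i j. i < m \<Longrightarrow> j < m \<Longrightarrow> A i j \<in> carrier_mat q q"
    and "\<And>i. i < m \<Longrightarrow> X i \<in> carrier_mat n n" and "r < q * n" "c < q * n"
  shows "quad_eval m q A n X $$ (r, c) =
    (\<Sum>i<m. \<Sum>j<m. A i j $$ (r div n, c div n) * (X i * X j) $$ (r mod n, c mod n))"
proof -
  have car: "kron (A i j) (X i * X j) \<in> carrier_mat (q * n) (q * n)" if "i < m" "j < m" for i j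
    using assms(1)[OF that] assms(2)[OF that(1)] assms(2)[OF that(2)]
    by (auto simp: kron_def)
  let ?M = "module_mat TYPE(real) (q * n) (q * n)"
  have inner: "finsum ?M (\<lambda>j. kron (A i j) (X i * X j)) {..<m} \<in> carrier_mat (q * n) (q * n) \<and>
      finsum ?M (\<lambda>j. kron (A i j) (X i * X j)) {..<m} $$ (r, c) =
      (\<Sum>j<m. kron (A i j) (X i * X j) $$ (r, c))" if "i < m" for i
    using car that assms(3,4) by (intro finsum_mat_index) auto
  have "quad_eval m q A n X $$ (r, c) =
      (\<Sum>i<m. finsum ?M (\<lambda>j. kron (A i j) (X i * X j)) {..<m} $$ (r, c))"
    unfolding quad_eval_def Let_def
    using inner assms(3,4) by (intro finsum_mat_index[THEN conjunct2]) auto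
  also have "\<dots> = (\<Sum>i<m. \<Sum>j<m. kron (A i j) (X i * X j) $$ (r, c))"
    using inner by (intro sum.cong) auto
  also have "\<dots> = (\<Sum>i<m. \<Sum>j<m. A i j $$ (r div n, c div n) * (X i * X j) $$ (r mod n, c mod n))"
  proof (intro sum.cong refl)
    fix i j assume "i \<in> {..<m}" "j \<in> {..<m}"
    then have "A i j \<in> carrier_mat q q" "X i \<in> carrier_mat n n" "X j \<in> carrier_mat n n"
      using assms(1,2) by auto
    then show "kron (A i j) (X i * X j) $$ (r, c) =
        A i j $$ (r div n, c div n) * (X i * X j) $$ (r mod n, c mod n)"
      using assms(3,4) by (auto simp: kron_def)
  qed
  finally show ?thesis .
qed

end

(* With w s (i, a) = (X i v a) s, where v = (v a) is split into q blocks of length n, one has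
   v . f(X) v = \<Sum>s. w s . A w s, where A denotes the coefficient matrix; so f(X) inherits
   positivity from A.  Conversely, for n = m + 1, X i = E(0, i + 1) + E(i + 1, 0) and
   v a = \<Sum>i. u(i, a) e(i + 1), the vector w 0 is the given u and all other w s vanish. *)
theory Submission
  imports Defs
begin

lemma mult_add_less_mult:
  assumes "a < q" "k < (n::nat)"
  shows "a * n + k < q * n"
proof -
  have "a * n + k < (a + 1) * n" using assms by simp
  also have "\<dots> \<le> q * n" using assms by (intro mult_right_mono) auto
  finally show ?thesis .
qed

text \<open>Division with remainder matches the indices below \<open>q * n\<close> with pairs of
  block and offset. \<open>kron\<close> and \<open>coeff_mat\<close> read flat indices through
  \<open>div\<close> and \<open>mod\<close>; this turns sums over such indices into double sums,
  with block length \<open>n\<close> for f(X) and \<open>q\<close> for the coefficient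
  matrix.\<close>

lemma sum_div_mod:
  fixes f :: "nat \<Rightarrow> nat \<Rightarrow> 'a::comm_monoid_add"
  shows "(\<Sum>r<q * n. f (r div n) (r mod n)) = (\<Sum>a<q. \<Sum>k<n. f a k)"
proof -
  have "(\<Sum>r<q * n. f (r div n) (r mod n)) = (\<Sum>(a, k)\<in>{..<q} \<times> {..<n}. f a k)"
  proof (rule sum.reindex_bij_witness[where i = "\<lambda>(a, k). a * n + k"
        and j = "\<lambda>r. (r div n, r mod n)"], goal_cases)
    case (2 r)
    then have "n > 0" by (cases n) auto
    with 2 show ?case by (auto simp: less_mult_imp_div_less)
  next
    case (4 p)
    then obtain a k where "p = (a, k)" "a < q" "k < n" by auto
    then show ?case using mult_add_less_mult by simp
  qed auto
  then show ?thesis by (simp add: sum.cartesian_product)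
qed

lemma quadratic_form_eq_sum:
  fixes M :: "'a::comm_semiring_0 mat"
  assumes "M \<in> carrier_mat N N" "v \<in> carrier_vec N"
  shows "v \<bullet> (M *\<^sub>v v) = (\<Sum>r<N. \<Sum>c<N. v $ r * M $$ (r, c) * v $ c)"
  using assms
  by (simp add: scalar_prod_def atLeast0LessThan sum_distrib_left mult.assoc)

text \<open>For fixed \<open>s\<close> the product \<open>Y i s k * Y j s l\<close> separates
  \<open>k\<close> from \<open>l\<close>. Once \<open>s\<close> is summed outermost, the sums over
  \<open>k\<close> and over \<open>l\<close> can each be collected into a factor of their
  own.\<close>

lemma sum_quadratic_regroup:
  fixes C :: "nat \<Rightarrow> nat \<Rightarrow> nat \<Rightarrow> nat \<Rightarrow> 'a::comm_semiring_0"
  shows "(\<Sum>a<q. \<Sum>k<n. \<Sum>b<q. \<Sum>l<n.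
      u a k * (\<Sum>i<m. \<Sum>j<m. C i j a b * (\<Sum>s<n. Y i s k * Y j s l)) * u b l) =
    (\<Sum>s<n. \<Sum>i<m. \<Sum>a<q. \<Sum>j<m. \<Sum>b<q.
      (\<Sum>k<n. Y i s k * u a k) * C i j a b * (\<Sum>l<n. Y j s l * u b l))"
proof -
  let ?T = "\<lambda>a k b l i j s. u a k * (C i j a b * (Y i s k * Y j s l)) * u b l"
  have "(\<Sum>a<q. \<Sum>k<n. \<Sum>b<q. \<Sum>l<n.
      u a k * (\<Sum>i<m. \<Sum>j<m. C i j a b * (\<Sum>s<n. Y i s k * Y j s l)) * u b l) =
    (\<Sum>a<q. \<Sum>k<n. \<Sum>b<q. \<Sum>l<n. \<Sum>i<m. \<Sum>j<m. \<Sum>s<n. ?T a k b l i j s)"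
    by (simp only: sum_distrib_left sum_distrib_right)
  \<comment> \<open>Merging the nested sums into one sum over a product set makes the exchange of
    summations a permutation of 7-tuples. The final order \<open>l\<close>, \<open>k\<close> is the
    one in which distributing the product below yields its sums.\<close>
  also have "\<dots> = (\<Sum>s<n. \<Sum>i<m. \<Sum>a<q. \<Sum>j<m. \<Sum>b<q. \<Sum>l<n. \<Sum>k<n. ?T a k b l i j s)"
    unfolding sum.cartesian_product
    by (rule sum.reindex_bij_witness[
          where j = "\<lambda>(a, k, b, l, i, j, s). (s, i, a, j, b, l, k)"
            and i = "\<lambda>(s, i, a, j, b, l, k). (a, k, b, l, i, j, s)"]) auto
  also have "\<dots> = (\<Sum>s<n. \<Sum>i<m. \<Sum>a<q. \<Sum>j<m. \<Sum>b<q.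
      (\<Sum>k<n. Y i s k * u a k) * C i j a b * (\<Sum>l<n. Y j s l * u b l))"
    by (simp only: sum_distrib_left sum_distrib_right) (simp only: mult_ac)
  finally show ?thesis .
qed

lemma coeff_mat_carrier: "coeff_mat m q A \<in> carrier_mat (m * q) (m * q)"
  by (simp add: coeff_mat_def)

lemma coeff_mat_sym:
  assumes "\<And>i j. i < m \<Longrightarrow> j < m \<Longrightarrow> A i j \<in> carrier_mat q q"
    and "\<And>i j. i < m \<Longrightarrow> j < m \<Longrightarrow> A i j = transpose_mat (A j i)"
  shows "coeff_mat m q A \<in> sym_mats (m * q)"
proof -
  have "coeff_mat m q A $$ (c, r) = coeff_mat m q A $$ (r, c)"
    if "r < m * q" "c < m * q" for r c
  proof -
    have "q > 0" using that by (cases q) auto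
    then have "r div q < m" "c div q < m" "r mod q < q" "c mod q < q"
      using that by (auto simp: less_mult_imp_div_less)
    then have "A (c div q) (r div q) $$ (c mod q, r mod q) =
        A (r div q) (c div q) $$ (r mod q, c mod q)"
      using assms(1)[of "r div q" "c div q"] assms(2)[of "c div q" "r div q"]
      by simp
    then show ?thesis using that by (simp add: coeff_mat_def)
  qed
  then show ?thesis
    using coeff_mat_carrier[of m q A] by (auto simp: sym_mats_def intro!: eq_matI)
qed

lemma quad_eval_carrier:
  assumes "q \<ge> 1" "n \<ge> 1"
    and "\<And>i j. i < m \<Longrightarrow> j < m \<Longrightarrow> A i j \<in> carrier_mat q q"
    and "\<And>i. i < m \<Longrightarrow> X i \<in> carrier_mat n n"
  shows "quad_eval m q A n X \<in> carrier_mat (q * n) (q * n)"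
proof -
  let ?M = "module_mat TYPE(real) (q * n) (q * n)"
  \<comment> \<open>\<open>finsum_mat_index\<close> gives the carrier together with an entry at an
    index in range; positivity of \<open>q * n\<close> supplies the index (0, 0).\<close>
  have pos: "0 < q * n" using assms(1,2) by simp
  have kron: "kron (A i j) (X i * X j) \<in> carrier_mat (q * n) (q * n)"
    if "i < m" "j < m" for i j
    using assms(3)[OF that] assms(4)[OF that(1)] assms(4)[OF that(2)]
    by (auto simp: kron_def)
  have inner: "finsum ?M (\<lambda>j. kron (A i j) (X i * X j)) {..<m} \<in> carrier_mat (q * n) (q * n)"
    if "i < m" for i
    by (rule conjunct1[OF finsum_mat_index[OF _ _ pos pos]]) (use kron that in auto)
  show ?thesis
    unfolding quad_eval_def Let_def
    by (rule conjunct1[OF finsum_mat_index[OF _ _ pos pos]]) (use inner in auto)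
qed

text \<open>Transposition sends the summand for (i, j) to the summand for (j, i), by the symmetry of
  the coefficients and of each \<open>X i\<close>, so it only permutes the double sum.\<close>

lemma quad_eval_sym:
  assumes "q \<ge> 1" "n \<ge> 1"
    and A: "\<And>i j. i < m \<Longrightarrow> j < m \<Longrightarrow> A i j \<in> carrier_mat q q"
    and At: "\<And>i j. i < m \<Longrightarrow> j < m \<Longrightarrow> A i j = transpose_mat (A j i)"
    and X: "\<And>i. i < m \<Longrightarrow> X i \<in> sym_mats n"
  shows "quad_eval m q A n X \<in> sym_mats (q * n)"
proof -
  have Xc: "X i \<in> carrier_mat n n" "transpose_mat (X i) = X i" if "i < m" for i
    using X[OF that] by (auto simp: sym_mats_def)
  have "quad_eval m q A n X $$ (c, r) = quad_eval m q A n X $$ (r, c)"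
    if rc: "r < q * n" "c < q * n" for r c
  proof -
    have lt: "r div n < q" "c div n < q" "r mod n < n" "c mod n < n"
      using rc assms(2) by (auto simp: less_mult_imp_div_less)
    have "quad_eval m q A n X $$ (c, r) =
      (\<Sum>i<m. \<Sum>j<m. A i j $$ (c div n, r div n) * (X i * X j) $$ (c mod n, r mod n))"
      by (rule quad_eval_index[OF A Xc(1) rc(2,1)])
    also have "\<dots> = (\<Sum>i<m. \<Sum>j<m. A j i $$ (r div n, c div n) * (X j * X i) $$ (r mod n, c mod n))"
    proof (intro sum.cong refl)
      fix i j assume "i \<in> {..<m}" "j \<in> {..<m}"
      then have ij: "i < m" "j < m" by auto
      have "X j * X i = transpose_mat (X i * X j)"
        using transpose_mult[OF Xc(1)[OF ij(1)] Xc(1)[OF ij(2)]] Xc(2) ij by simp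
      then have "(X j * X i) $$ (r mod n, c mod n) = (X i * X j) $$ (c mod n, r mod n)"
        using lt Xc(1)[OF ij(1)] Xc(1)[OF ij(2)] by simp
      moreover have "A j i $$ (r div n, c div n) = A i j $$ (c div n, r div n)"
        using At[OF ij(2,1)] A[OF ij] lt by simp
      ultimately show "A i j $$ (c div n, r div n) * (X i * X j) $$ (c mod n, r mod n) =
          A j i $$ (r div n, c div n) * (X j * X i) $$ (r mod n, c mod n)"
        by simp
    qed
    also have "\<dots> = quad_eval m q A n X $$ (r, c)"
      by (subst sum.swap) (rule quad_eval_index[OF A Xc(1) rc, symmetric])
    finally show ?thesis .
  qed
  moreover have "quad_eval m q A n X \<in> carrier_mat (q * n) (q * n)"
    by (rule quad_eval_carrier[OF assms(1,2) A Xc(1)])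
  ultimately show ?thesis
    by (auto simp: sym_mats_def intro!: eq_matI)
qed

text \<open>By symmetry of \<open>X i\<close>, entry (k, l) of \<open>X i * X j\<close> is the sum
  over \<open>s\<close> of \<open>X i $$ (s, k) * X j $$ (s, l)\<close>. Hence the form of f(X)
  splits into one form of the coefficient matrix for each row \<open>s\<close>. Both directions of
  the theorem rest on this identity.\<close>

lemma quadratic_form_quad_eval:
  assumes "q \<ge> 1" "n \<ge> 1"
    and A: "\<And>i j. i < m \<Longrightarrow> j < m \<Longrightarrow> A i j \<in> carrier_mat q q"
    and X: "\<And>i. i < m \<Longrightarrow> X i \<in> sym_mats n"
    and v: "v \<in> carrier_vec (q * n)"
  defines "w \<equiv> \<lambda>s. vec (m * q) (\<lambda>r. \<Sum>k<n. X (r div q) $$ (s, k) * v $ (r mod q * n + k))"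
  shows "v \<bullet> (quad_eval m q A n X *\<^sub>v v) = (\<Sum>s<n. w s \<bullet> (coeff_mat m q A *\<^sub>v w s))"
proof -
  have Xc: "X i \<in> carrier_mat n n" if "i < m" for i
    using X[OF that] by (simp add: sym_mats_def)
  \<comment> \<open>Used on the left factor of \<open>X i * X j\<close>, so that \<open>s\<close> is
    the row index in both factors.\<close>
  have Xs: "X i $$ (k, s) = X i $$ (s, k)" if "i < m" "k < n" "s < n" for i k s
    using X[OF that(1)] that(2,3) index_transpose_mat(1)[of s "X i" k]
    by (auto simp: sym_mats_def)
  \<comment> \<open>With block and offset as separate arguments, \<open>F\<close> and
    \<open>G\<close> become the summands of the two sides of
    \<open>sum_quadratic_regroup\<close>.\<close>
  define u where "u = (\<lambda>a k. v $ (a * n + k))"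
  define C where "C = (\<lambda>i j a b. A i j $$ (a, b))"
  define Y where "Y = (\<lambda>i s k. X i $$ (s, k))"
  define F where
    "F = (\<lambda>a k b l. u a k * (\<Sum>i<m. \<Sum>j<m. C i j a b * (\<Sum>s<n. Y i s k * Y j s l)) * u b l)"
  define G where
    "G = (\<lambda>s i a j b. (\<Sum>k<n. Y i s k * u a k) * C i j a b * (\<Sum>l<n. Y j s l * u b l))"
  have "v \<bullet> (quad_eval m q A n X *\<^sub>v v) =
      (\<Sum>r<q * n. \<Sum>c<q * n. v $ r * quad_eval m q A n X $$ (r, c) * v $ c)"
    using quad_eval_carrier[OF assms(1,2) A Xc] v by (intro quadratic_form_eq_sum) auto
  also have "\<dots> = (\<Sum>r<q * n. \<Sum>c<q * n. F (r div n) (r mod n) (c div n) (c mod n))"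
  proof (intro sum.cong refl)
    fix r c assume "r \<in> {..<q * n}" "c \<in> {..<q * n}"
    then have rc: "r < q * n" "c < q * n" by auto
    have lt: "r mod n < n" "c mod n < n" using assms(2) by auto
    have "(X i * X j) $$ (r mod n, c mod n) = (\<Sum>s<n. Y i s (r mod n) * Y j s (c mod n))"
      if "i < m" "j < m" for i j
      using Xc[OF that(1)] Xc[OF that(2)] lt Xs[OF that(1)]
      by (simp add: scalar_prod_def atLeast0LessThan Y_def)
    then have "quad_eval m q A n X $$ (r, c) =
        (\<Sum>i<m. \<Sum>j<m. C i j (r div n) (c div n) * (\<Sum>s<n. Y i s (r mod n) * Y j s (c mod n)))"
      using quad_eval_index[OF A Xc rc] by (simp add: C_def)
    then show "v $ r * quad_eval m q A n X $$ (r, c) * v $ c =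
        F (r div n) (r mod n) (c div n) (c mod n)"
      by (simp add: F_def u_def)
  qed
  \<comment> \<open>The column index is split first, then the row index; the explicit functions fix
    which \<open>div\<close> and \<open>mod\<close> terms are abstracted.\<close>
  also have "\<dots> = (\<Sum>a<q. \<Sum>k<n. \<Sum>b<q. \<Sum>l<n. F a k b l)"
    by (simp only: sum_div_mod[of "\<lambda>b l. F _ _ b l"]
        sum_div_mod[of "\<lambda>a k. \<Sum>b<q. \<Sum>l<n. F a k b l"])
  also have "\<dots> = (\<Sum>s<n. \<Sum>i<m. \<Sum>a<q. \<Sum>j<m. \<Sum>b<q. G s i a j b)"
    unfolding F_def G_def by (rule sum_quadratic_regroup)
  also have "\<dots> = (\<Sum>s<n. w s \<bullet> (coeff_mat m q A *\<^sub>v w s))"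
  proof (rule sum.cong[OF refl])
    fix s
    have "w s \<bullet> (coeff_mat m q A *\<^sub>v w s) =
        (\<Sum>r<m * q. \<Sum>c<m * q. w s $ r * coeff_mat m q A $$ (r, c) * w s $ c)"
      using coeff_mat_carrier by (intro quadratic_form_eq_sum) (auto simp: w_def)
    also have "\<dots> = (\<Sum>r<m * q. \<Sum>c<m * q. G s (r div q) (r mod q) (c div q) (c mod q))"
      by (intro sum.cong refl) (simp add: w_def coeff_mat_def G_def Y_def u_def C_def)
    also have "\<dots> = (\<Sum>i<m. \<Sum>a<q. \<Sum>j<m. \<Sum>b<q. G s i a j b)"
      by (simp only: sum_div_mod[of "\<lambda>j b. G s _ _ j b"]
          sum_div_mod[of "\<lambda>i a. \<Sum>j<m. \<Sum>b<q. G s i a j b"])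
    finally show "(\<Sum>i<m. \<Sum>a<q. \<Sum>j<m. \<Sum>b<q. G s i a j b) =
        w s \<bullet> (coeff_mat m q A *\<^sub>v w s)" by simp
  qed
  finally show ?thesis .
qed

theorem theorem4p1:
  fixes m q :: nat and A :: "nat \<Rightarrow> nat \<Rightarrow> real mat"
  assumes "m \<ge> 1" and "q \<ge> 1"
    and "\<And>i j. i < m \<Longrightarrow> j < m \<Longrightarrow> A i j \<in> carrier_mat q q"
    and "\<And>i j. i < m \<Longrightarrow> j < m \<Longrightarrow> A i j = transpose_mat (A j i)"
  shows "(\<forall>n\<ge>1. \<forall>X. (\<forall>i<m. X i \<in> sym_mats n) \<longrightarrow> pos_semidef (quad_eval m q A n X))
     \<longleftrightarrow> pos_semidef (coeff_mat m q A)"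
proof
  assume f_pos: "\<forall>n\<ge>1. \<forall>X. (\<forall>i<m. X i \<in> sym_mats n) \<longrightarrow> pos_semidef (quad_eval m q A n X)"
  define n where "n = m + 1"
  \<comment> \<open>\<open>X i\<close> is the adjacency matrix of the edge from 0 to i + 1 in a star
    with centre 0 and one leaf per variable. Row 0 reads coordinate i + 1, row i + 1 reads
    coordinate 0, and all other rows vanish.\<close>
  define X :: "nat \<Rightarrow> real mat" where
    "X = (\<lambda>i. mat n n (\<lambda>(r, c). if r = 0 \<and> c = i + 1 \<or> r = i + 1 \<and> c = 0 then 1 else 0))"
  have n: "n \<ge> 1" by (simp add: n_def)
  have X: "X i \<in> sym_mats n" for i
    by (auto simp: X_def sym_mats_def intro!: eq_matI)
  have psd: "pos_semidef (quad_eval m q A n X)" using f_pos n X by blast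
  have "quad_eval m q A n X \<in> sym_mats (q * n)"
    by (rule quad_eval_sym[OF assms(2) n assms(3,4) X])
  \<comment> \<open>\<open>pos_semidef\<close> takes its test vectors in dimension
    \<open>dim_row\<close>, which must be known before \<open>v\<close> can be inserted.\<close>
  then have dim: "dim_row (quad_eval m q A n X) = q * n"
    by (auto simp: sym_mats_def)
  have "0 \<le> u \<bullet> (coeff_mat m q A *\<^sub>v u)" if u: "u \<in> carrier_vec (m * q)" for u
  proof -
    \<comment> \<open>\<open>u\<close> lists its entries by variable and then by \<open>a\<close>,
      while \<open>v\<close> lists them by \<open>a\<close> and then by leaf, hence the exchanged
      roles of \<open>div\<close> and \<open>mod\<close>; the \<open>- 1\<close> undoes the shift of
      the leaves. The centre coordinate of each block is 0.\<close>
    define v where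
      "v = vec (q * n) (\<lambda>r. if r mod n = 0 then 0 else u $ ((r mod n - 1) * q + r div n))"
    define w where
      "w = (\<lambda>s. vec (m * q) (\<lambda>r. \<Sum>k<n. X (r div q) $$ (s, k) * v $ (r mod q * n + k)))"
    have v_index: "v $ (a * n + k) = (if k = 0 then 0 else u $ ((k - 1) * q + a))"
      if "a < q" "k < n" for a k
      using that mult_add_less_mult[OF that] by (simp add: v_def)
    have w: "w s = (if s = 0 then u else 0\<^sub>v (m * q))" if s: "s < n" for s
    proof (rule eq_vecI)
      fix r assume "r < dim_vec (if s = 0 then u else 0\<^sub>v (m * q))"
      then have r: "r < m * q" using u by (auto split: if_splits)
      have lt: "r div q < m" "r mod q < q"
        using r assms(2) by (auto simp: less_mult_imp_div_less)
      have "w s $ r = (\<Sum>k<n. X (r div q) $$ (s, k) * v $ (r mod q * n + k))"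
        using r by (simp add: w_def)
      \<comment> \<open>For \<open>s = 0\<close> only the leaf of variable \<open>r div q\<close>
        contributes, and there \<open>v\<close> holds entry
        \<open>(r div q) * q + r mod q = r\<close> of \<open>u\<close>. For \<open>s > 0\<close> a
        row can only read the centre, where \<open>v\<close> is 0.\<close>
      also have "\<dots> = (\<Sum>k<n. if k = r div q + 1 then if s = 0 then u $ r else 0 else 0)"
        using s lt by (intro sum.cong refl) (auto simp: X_def v_index)
      also have "\<dots> = (if s = 0 then u else 0\<^sub>v (m * q)) $ r"
        using lt r by (simp add: n_def)
      finally show "w s $ r = (if s = 0 then u else 0\<^sub>v (m * q)) $ r" .
    qed (use u in \<open>auto simp: w_def\<close>)
    have v: "v \<in> carrier_vec (q * n)" by (simp add: v_def)
    have "v \<bullet> (quad_eval m q A n X *\<^sub>v v) = (\<Sum>s<n. w s \<bullet> (coeff_mat m q A *\<^sub>v w s))"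
      unfolding w_def by (rule quadratic_form_quad_eval[OF assms(2) n assms(3) X v])
    also have "\<dots> = (\<Sum>s<n. if s = 0 then u \<bullet> (coeff_mat m q A *\<^sub>v u) else 0)"
      using coeff_mat_carrier[of m q A] by (intro sum.cong refl) (auto simp: w)
    also have "\<dots> = u \<bullet> (coeff_mat m q A *\<^sub>v u)"
      using n by simp
    finally show ?thesis
      using psd v dim by (auto simp: pos_semidef_def)
  qed
  then show "pos_semidef (coeff_mat m q A)"
    using coeff_mat_sym[OF assms(3,4)] coeff_mat_carrier[of m q A]
    by (auto simp: pos_semidef_def)
next
  assume psd: "pos_semidef (coeff_mat m q A)"
  show "\<forall>n\<ge>1. \<forall>X. (\<forall>i<m. X i \<in> sym_mats n) \<longrightarrow> pos_semidef (quad_eval m q A n X)"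
  proof (intro allI impI)
    fix n :: nat and X :: "nat \<Rightarrow> real mat"
    assume n: "1 \<le> n" and "\<forall>i<m. X i \<in> sym_mats n"
    then have X: "\<And>i. i < m \<Longrightarrow> X i \<in> sym_mats n" by blast
    have sym: "quad_eval m q A n X \<in> sym_mats (q * n)"
      by (rule quad_eval_sym[OF assms(2) n assms(3,4) X])
    have "0 \<le> v \<bullet> (quad_eval m q A n X *\<^sub>v v)" if v: "v \<in> carrier_vec (q * n)" for v
      \<comment> \<open>Each summand is the form of the coefficient matrix at some vector of length
        \<open>m * q\<close>, hence nonnegative.\<close>
      using psd coeff_mat_carrier[of m q A]
      by (subst quadratic_form_quad_eval[OF assms(2) n assms(3) X v])
        (auto simp: pos_semidef_def intro!: sum_nonneg)
    then show "pos_semidef (quad_eval m q A n X)"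
      using sym by (auto simp: pos_semidef_def sym_mats_def)
  qed
qed

end
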